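(* There are continuum many pairwise definably distinct cyclically ordered groups expanding $(\mathbb{Z};+)$; that is, there is a family of $2^{\aleph_0}$ additive cyclic orders $C$ on $\mathbb{Z}$ such that the structures $(\mathbb{Z};+,C)$, for $C$ in the family, are pairwise not definably equivalent.
   Context: A cyclic order on a set $G$ is a ternary relation $C\subseteq G^3$ such that for all $a,b,c,d\in G$: (1) if $(a,b,c)\in C$ then $(b,c,a)\in C$; (2) if $(a,b,c)\in C$ then $(c,b,a)\notin C$; (3) if $(a,b,c)\in C$ and $(a,c,d)\in C$ then $(a,b,d)\in C$; (4) if $a,b,c$ are distinct then $(a,b,c)\in C$ or $(c,b,a)\in C$. A cyclic order $C$ on an abelian group $(G;+)$ is additive if $(a,b,c)\in C$ implies $(a+d,b+d,c+d)\in C$ for all $d\in G$. "Definable" means first-order definable, parameters allowed. If $\mathscr{M}_1$ and $\mathscr{M}_2$ are structures with the same underlying set $M$, $\mathscr{M}_1$ is a reduct of $\mathscr{M}_2$ if every $\mathscr{M}_1$-definable set (subset of some $M^k$) is definable in $\mathscr{M}_2$. Two structures on the same underlying set are definably equivalent if each is a reduct of the other, and definably distinct otherwise. *)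

theory Defs
  imports Main "HOL-Library.Equipollence"
begin

section \<open>Cyclic orders\<close>

definition cyclic_order_on :: "'a set \<Rightarrow> ('a \<times> 'a \<times> 'a) set \<Rightarrow> bool" where
  "cyclic_order_on G C \<longleftrightarrow>
     C \<subseteq> G \<times> G \<times> G \<and>
     (\<forall>a\<in>G. \<forall>b\<in>G. \<forall>c\<in>G. (a, b, c) \<in> C \<longrightarrow> (b, c, a) \<in> C) \<and>
     (\<forall>a\<in>G. \<forall>b\<in>G. \<forall>c\<in>G. (a, b, c) \<in> C \<longrightarrow> (c, b, a) \<notin> C) \<and>
     (\<forall>a\<in>G. \<forall>b\<in>G. \<forall>c\<in>G. \<forall>d\<in>G. (a, b, c) \<in> C \<and> (a, c, d) \<in> C \<longrightarrow> (a, b, d) \<in> C) \<and>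
     (\<forall>a\<in>G. \<forall>b\<in>G. \<forall>c\<in>G. a \<noteq> b \<and> b \<noteq> c \<and> a \<noteq> c \<longrightarrow> (a, b, c) \<in> C \<or> (c, b, a) \<in> C)"

definition additive_cyclic_order :: "('a::ab_group_add \<times> 'a \<times> 'a) set \<Rightarrow> bool" where
  "additive_cyclic_order C \<longleftrightarrow>
     cyclic_order_on UNIV C \<and>
     (\<forall>a b c d. (a, b, c) \<in> C \<longrightarrow> (a + d, b + d, c + d) \<in> C)"

section \<open>First-order structures and definability\<close>

datatype 'f fo_term = Var nat | Fun 'f "'f fo_term list"

datatype ('f, 'r) fo_formula =
    Eq "'f fo_term" "'f fo_term"
  | Rel 'r "'f fo_term list"
  | Neg "('f, 'r) fo_formula"
  | And "('f, 'r) fo_formula" "('f, 'r) fo_formula"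
  | Ex nat "('f, 'r) fo_formula"

text \<open>A structure, together with its language, whose underlying set is the whole type
  \<open>'m\<close>; symbols are interpreted on argument lists, and only the values on lists of
  the prescribed arity are ever used by well-formed formulas.\<close>

record ('f, 'r, 'm) fo_structure =
  fun_arity :: "'f \<Rightarrow> nat"
  rel_arity :: "'r \<Rightarrow> nat"
  fun_interp :: "'f \<Rightarrow> 'm list \<Rightarrow> 'm"
  rel_interp :: "'r \<Rightarrow> 'm list \<Rightarrow> bool"

primrec wf_term :: "('f, 'r, 'm) fo_structure \<Rightarrow> 'f fo_term \<Rightarrow> bool" where
  "wf_term M (Var n) \<longleftrightarrow> True"
| "wf_term M (Fun f ts) \<longleftrightarrow> length ts = fun_arity M f \<and> list_all (wf_term M) ts"

primrec wf_formula :: "('f, 'r, 'm) fo_structure \<Rightarrow> ('f, 'r) fo_formula \<Rightarrow> bool" where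
  "wf_formula M (Eq s t) \<longleftrightarrow> wf_term M s \<and> wf_term M t"
| "wf_formula M (Rel r ts) \<longleftrightarrow> length ts = rel_arity M r \<and> list_all (wf_term M) ts"
| "wf_formula M (Neg \<phi>) \<longleftrightarrow> wf_formula M \<phi>"
| "wf_formula M (And \<phi> \<psi>) \<longleftrightarrow> wf_formula M \<phi> \<and> wf_formula M \<psi>"
| "wf_formula M (Ex n \<phi>) \<longleftrightarrow> wf_formula M \<phi>"

primrec term_vars :: "'f fo_term \<Rightarrow> nat set" where
  "term_vars (Var n) = {n}"
| "term_vars (Fun f ts) = \<Union> (set (map term_vars ts))"

primrec free_vars :: "('f, 'r) fo_formula \<Rightarrow> nat set" where
  "free_vars (Eq s t) = term_vars s \<union> term_vars t"
| "free_vars (Rel r ts) = (\<Union>t\<in>set ts. term_vars t)"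
| "free_vars (Neg \<phi>) = free_vars \<phi>"
| "free_vars (And \<phi> \<psi>) = free_vars \<phi> \<union> free_vars \<psi>"
| "free_vars (Ex n \<phi>) = free_vars \<phi> - {n}"

primrec term_value :: "('f, 'r, 'm) fo_structure \<Rightarrow> (nat \<Rightarrow> 'm) \<Rightarrow> 'f fo_term \<Rightarrow> 'm" where
  "term_value M e (Var n) = e n"
| "term_value M e (Fun f ts) = fun_interp M f (map (term_value M e) ts)"

primrec satisfies ::
  "('f, 'r, 'm) fo_structure \<Rightarrow> (nat \<Rightarrow> 'm) \<Rightarrow> ('f, 'r) fo_formula \<Rightarrow> bool" where
  "satisfies M e (Eq s t) \<longleftrightarrow> term_value M e s = term_value M e t"
| "satisfies M e (Rel r ts) \<longleftrightarrow> rel_interp M r (map (term_value M e) ts)"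
| "satisfies M e (Neg \<phi>) \<longleftrightarrow> \<not> satisfies M e \<phi>"
| "satisfies M e (And \<phi> \<psi>) \<longleftrightarrow> satisfies M e \<phi> \<and> satisfies M e \<psi>"
| "satisfies M e (Ex n \<phi>) \<longleftrightarrow> (\<exists>a. satisfies M (e(n := a)) \<phi>)"

text \<open>The power \<open>M\<^sup>k\<close> is represented by the lists of length \<open>k\<close>. Variables
  \<open>0, \<dots>, k - 1\<close> range over the tuple, and the following ones are assigned the
  finitely many parameters \<open>ps\<close>.\<close>

definition definable :: "('f, 'r, 'm) fo_structure \<Rightarrow> nat \<Rightarrow> 'm list set \<Rightarrow> bool" where
  "definable M k S \<longleftrightarrow>
     (\<exists>\<phi> ps. wf_formula M \<phi> \<and> free_vars \<phi> \<subseteq> {..<k + length ps} \<and>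
        S = {xs. length xs = k \<and> satisfies M (\<lambda>i. (xs @ ps) ! i) \<phi>})"

definition reduct_of ::
  "('f, 'r, 'm) fo_structure \<Rightarrow> ('g, 's, 'm) fo_structure \<Rightarrow> bool" where
  "reduct_of M N \<longleftrightarrow> (\<forall>k S. definable M k S \<longrightarrow> definable N k S)"

definition definably_equivalent ::
  "('f, 'r, 'm) fo_structure \<Rightarrow> ('g, 's, 'm) fo_structure \<Rightarrow> bool" where
  "definably_equivalent M N \<longleftrightarrow> reduct_of M N \<and> reduct_of N M"

section \<open>The structure \<open>(G; +, C)\<close>\<close>

datatype add_symbol = Add
datatype cyc_symbol = Cyc

definition cyc_structure ::
  "('a::ab_group_add \<times> 'a \<times> 'a) set \<Rightarrow> (add_symbol, cyc_symbol, 'a) fo_structure" where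
  "cyc_structure C =
     \<lparr> fun_arity = (\<lambda>_. 2),
       rel_arity = (\<lambda>_. 3),
       fun_interp = (\<lambda>_ xs. xs ! 0 + xs ! 1),
       rel_interp = (\<lambda>_ xs. (xs ! 0, xs ! 1, xs ! 2) \<in> C) \<rparr>"

end

theory Submission
  imports Defs "HOL-Analysis.Abstract_Topology_2"
begin

text \<open>
  The theorem is a counting argument. Every irrational \<open>\<alpha>\<close> in the unit interval gives an
  additive cyclic order on \<open>\<int>\<close>: embed \<open>\<int>\<close> in the circle \<open>\<real>/\<int>\<close> by \<open>a \<mapsto> a\<alpha>\<close> and pull the
  cyclic order of the circle back. The order remembers \<open>\<alpha>\<close>, because it tells at which steps
  the walk \<open>0, \<alpha>, 2\<alpha>, \<dots>\<close> passes through \<open>0\<close>, and the number of passages in the first \<open>n\<close>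
  steps is \<open>\<lfloor>n\<alpha>\<rfloor>\<close> (\<open>inj_on_rotation_order\<close>). This produces continuum many additive cyclic
  orders.

  On the other hand, a structure on a countable set in a countable language has only countably
  many definable sets, since each of them is given by a formula and a finite list of
  parameters. If \<open>(\<int>; +, C)\<close> is a reduct of \<open>(\<int>; +, D)\<close>, then in particular \<open>C\<close> is definable
  in \<open>(\<int>; +, D)\<close>; so for a fixed \<open>D\<close> there are only countably many such \<open>C\<close>
  (\<open>countable_reducts\<close>). Definable equivalence therefore cuts a set of size
  continuum into countable classes. There must be continuum many classes
  (\<open>image_eqpoll_if_countable_fibres\<close>), and a set of representatives is the required family.
\<close>

section \<open>Maps with countable fibres\<close>

text \<open>
  A map with countable fibres embeds its domain in the product of its image with \<open>\<nat>\<close>, and for an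
  infinite image this product is no larger than the image. This gives the size both of
  a set of representatives of countable classes and of the complement of a countable set.
\<close>

lemma image_eqpoll_if_countable_fibres:
  assumes unc: "uncountable X"
    and fibres: "\<And>x. x \<in> X \<Longrightarrow> countable {y \<in> X. f y = f x}"
  shows "f ` X \<approx> X"
proof (rule lepoll_antisym)
  show "f ` X \<lesssim> X"
    by (rule image_lepoll)
next
  have inf: "infinite (f ` X)"
  proof
    assume "finite (f ` X)"
    then have "countable (\<Union>z \<in> f ` X. {y \<in> X. f y = z})"
      using fibres by (intro countable_UN) (auto intro: countable_finite)
    moreover have "X \<subseteq> (\<Union>z \<in> f ` X. {y \<in> X. f y = z})"
      by blast
    ultimately show False
      using unc countable_subset by blast
  qed
  define g where "g x = (f x, to_nat_on {y \<in> X. f y = f x} x)" for x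
  have "inj_on g X"
  proof (rule inj_onI)
    fix x y
    assume xy: "x \<in> X" "y \<in> X" "g x = g y"
    then have "f y = f x"
      by (simp add: g_def)
    with xy show "x = y"
      using fibres[of x] by (auto simp: g_def dest: inj_on_to_nat_on inj_onD)
  qed
  moreover have "g ` X \<subseteq> f ` X \<times> (UNIV :: nat set)"
    by (auto simp: g_def)
  ultimately have "X \<lesssim> f ` X \<times> (UNIV :: nat set)"
    unfolding lepoll_def by blast
  also have "f ` X \<times> (UNIV :: nat set) \<lesssim> f ` X \<times> f ` X"
    using inf by (intro times_lepoll_mono) (auto simp: infinite_le_lepoll)
  also have "f ` X \<times> f ` X \<approx> f ` X"
    using inf by (simp add: eqpoll_iff_card_of_ordIso card_of_Times_same_infinite)
  finally show "X \<lesssim> f ` X" .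
qed

lemma irrational_unit_interval_eqpoll: "{0<..<1::real} - \<rat> \<approx> (UNIV :: real set)"
proof -
  have unc: "uncountable {0<..<1::real}"
    by (simp add: uncountable_open_interval)
  then have "uncountable ({0<..<1::real} - \<rat>)"
    by (simp add: countable_rat uncountable_minus_countable)
  then obtain x :: real where x: "x \<in> {0<..<1} - \<rat>"
    by (metis countable_empty equals0I)
  \<comment> \<open>Sending all rationals to one irrational is a map with countable fibres.\<close>
  define f where "f y = (if y \<in> \<rat> then x else y)" for y
  have "{y \<in> {0<..<1}. f y = f z} \<subseteq> insert (f z) \<rat>" for z
    by (auto simp: f_def)
  then have "countable {y \<in> {0<..<1}. f y = f z}" for z
    by (rule countable_subset) (simp add: countable_rat)
  then have "f ` {0<..<1} \<approx> {0<..<1::real}"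
    using unc by (intro image_eqpoll_if_countable_fibres)
  moreover have "f ` {0<..<1} = {0<..<1} - \<rat>"
    using x by (force simp: f_def)
  ultimately show ?thesis
    using eqpoll_trans[OF _ open_interval_eqpoll_reals[of 0 1, THEN iffD2]] by simp
qed

section \<open>Rotation orders on the integers\<close>

text \<open>
  Bending the two ends of a line together turns a linear order into a cyclic one: going round
  from \<open>a\<close> through \<open>b\<close> to \<open>c\<close> means that some rotation of the triple is increasing.
\<close>

definition pullback_order :: "('a \<Rightarrow> 'b::linorder) \<Rightarrow> ('a \<times> 'a \<times> 'a) set" where
  "pullback_order t =
     {(a, b, c). t a < t b \<and> t b < t c \<or> t b < t c \<and> t c < t a \<or> t c < t a \<and> t a < t b}"

lemma cyclic_order_pullback_order:
  fixes t :: "'a \<Rightarrow> 'b::linorder"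
  assumes "inj t"
  shows "cyclic_order_on UNIV (pullback_order t)"
proof -
  have comparable: "t a < t b \<or> t b < t a" if "a \<noteq> b" for a b
    using that assms by (metis injD neq_iff)
  show ?thesis
    unfolding cyclic_order_on_def
  proof (intro conjI ballI impI)
    fix a b c :: 'a
    assume "a \<noteq> b \<and> b \<noteq> c \<and> a \<noteq> c"
    then show "(a, b, c) \<in> pullback_order t \<or> (c, b, a) \<in> pullback_order t"
      using comparable[of a b] comparable[of b c] comparable[of a c]
      by (auto simp: pullback_order_def)
  next
    fix a b c d :: 'a
    assume "(a, b, c) \<in> pullback_order t \<and> (a, c, d) \<in> pullback_order t"
    then show "(a, b, d) \<in> pullback_order t"
      unfolding pullback_order_def mem_Collect_eq prod.case
      by (elim conjE disjE) auto
  qed (auto simp: pullback_order_def)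
qed

text \<open>The circle \<open>\<real>/\<int>\<close> is cut open at \<open>0\<close> here, so that its points are fractional parts.\<close>

definition rotation_order :: "real \<Rightarrow> (int \<times> int \<times> int) set" where
  "rotation_order \<alpha> = pullback_order (\<lambda>a. frac (of_int a * \<alpha>))"

lemma inj_frac_multiples:
  assumes "\<alpha> \<notin> \<rat>"
  shows "inj (\<lambda>a::int. frac (of_int a * \<alpha>))"
proof (rule injI, rule ccontr)
  fix a b :: int
  assume eq: "frac (of_int a * \<alpha>) = frac (of_int b * \<alpha>)" and "a \<noteq> b"
  define k where "k = \<lfloor>of_int a * \<alpha>\<rfloor> - \<lfloor>of_int b * \<alpha>\<rfloor>"
  have "of_int (a - b) * \<alpha> = of_int k"
    using eq by (simp add: frac_def k_def algebra_simps)
  then have "\<alpha> = of_int k / of_int (a - b)"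
    using \<open>a \<noteq> b\<close> by (simp add: field_simps)
  then have "\<alpha> \<in> \<rat>"
    by (metis Rats_divide Rats_of_int)
  with assms show False ..
qed

text \<open>
  Translating by \<open>d\<close> rotates the circle; in the cut-open picture the points that pass the cut
  drop by \<open>1\<close>, and these are the top ones, so the linear order only changes by a cyclic shift.
\<close>

lemma additive_rotation_order:
  assumes "\<alpha> \<notin> \<rat>"
  shows "additive_cyclic_order (rotation_order \<alpha>)"
  unfolding additive_cyclic_order_def
proof (intro conjI allI impI)
  show "cyclic_order_on UNIV (rotation_order \<alpha>)"
    unfolding rotation_order_def
    by (intro cyclic_order_pullback_order inj_frac_multiples assms)
next
  fix a b c d :: int
  define t where "t a = frac (of_int a * \<alpha>)" for a :: int
  have shift: "t (x + d) = (if t x + t d < 1 then t x + t d else t x + t d - 1)" for x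
    by (simp add: t_def distrib_right frac_add)
  have bounds: "0 \<le> t x" "t x < 1" for x
    by (simp_all add: t_def frac_lt_1)
  assume "(a, b, c) \<in> rotation_order \<alpha>"
  then have "t a < t b \<and> t b < t c \<or> t b < t c \<and> t c < t a \<or> t c < t a \<and> t a < t b"
    by (simp add: rotation_order_def pullback_order_def t_def)
  then have "t (a + d) < t (b + d) \<and> t (b + d) < t (c + d)
      \<or> t (b + d) < t (c + d) \<and> t (c + d) < t (a + d)
      \<or> t (c + d) < t (a + d) \<and> t (a + d) < t (b + d)"
    unfolding shift using bounds[of a] bounds[of b] bounds[of c] bounds[of d]
    by (cases "t a + t d < 1"; cases "t b + t d < 1"; cases "t c + t d < 1"; simp; linarith)
  then show "(a + d, b + d, c + d) \<in> rotation_order \<alpha>"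
    by (simp add: rotation_order_def pullback_order_def t_def)
qed

text \<open>
  A step of length \<open>\<alpha> < 1\<close> passes through \<open>0\<close> exactly if it decreases the fractional part. The
  order sees this: since \<open>0\<close> is the least fractional part, the triple \<open>(0, b, c)\<close> is in the order
  exactly if the fractional part at the nonzero integer \<open>b\<close> is smaller than the one at \<open>c\<close>.
\<close>

lemma floor_multiple_Suc:
  assumes "\<alpha> \<in> {0<..<1} - \<rat>"
  shows "\<lfloor>of_int (int (Suc n)) * \<alpha>\<rfloor> =
    \<lfloor>of_int (int n) * \<alpha>\<rfloor> + (if (0, int (Suc n), int n) \<in> rotation_order \<alpha> then 1 else 0)"
proof -
  define t where "t a = frac (of_int a * \<alpha>)" for a :: int
  have t0: "t 0 = 0" and bounds: "0 \<le> t x" "t x < 1" for x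
    by (simp_all add: t_def frac_lt_1)
  have "t (int (Suc n)) \<noteq> t 0"
    using inj_frac_multiples[of \<alpha>, THEN injD, of "int (Suc n)" 0] assms unfolding t_def
    by fastforce
  then have mem: "(0, int (Suc n), int n) \<in> rotation_order \<alpha> \<longleftrightarrow> t (int (Suc n)) < t (int n)"
    using bounds[of "int n"] bounds[of "int (Suc n)"] t0
    by (auto simp: rotation_order_def pullback_order_def simp flip: t_def)
  have eq: "of_int (int (Suc n)) * \<alpha> = of_int (int n) * \<alpha> + \<alpha>"
    by (simp add: algebra_simps)
  have frac_step: "t (int (Suc n)) =
      (if t (int n) + \<alpha> < 1 then t (int n) + \<alpha> else t (int n) + \<alpha> - 1)"
    using assms unfolding t_def eq by (simp add: frac_add frac_eq[THEN iffD2])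
  have floor_step: "\<lfloor>of_int (int (Suc n)) * \<alpha>\<rfloor> =
      \<lfloor>of_int (int n) * \<alpha>\<rfloor> + (if t (int n) + \<alpha> < 1 then 0 else 1)"
    using assms unfolding t_def eq by (simp add: floor_add frac_eq[THEN iffD2] floor_eq_iff)
  have "t (int (Suc n)) < t (int n) \<longleftrightarrow> \<not> t (int n) + \<alpha> < 1"
    using frac_step assms by auto
  then show ?thesis
    using mem floor_step by simp
qed

text \<open>The integers \<open>\<lfloor>n\<alpha>\<rfloor>\<close> determine \<open>\<alpha>\<close>, as \<open>\<lfloor>n\<alpha>\<rfloor> / n\<close> tends to \<open>\<alpha>\<close>.\<close>

lemma inj_on_rotation_order: "inj_on rotation_order ({0<..<1} - \<rat>)"
proof (rule inj_onI, rule ccontr)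
  fix \<alpha> \<beta> :: real
  assume \<alpha>: "\<alpha> \<in> {0<..<1} - \<rat>" and \<beta>: "\<beta> \<in> {0<..<1} - \<rat>"
    and eq: "rotation_order \<alpha> = rotation_order \<beta>" and "\<alpha> \<noteq> \<beta>"
  have floor_eq: "\<lfloor>of_int (int n) * \<alpha>\<rfloor> = \<lfloor>of_int (int n) * \<beta>\<rfloor>" for n
  proof (induction n)
    case (Suc n)
    then show ?case
      unfolding floor_multiple_Suc[OF \<alpha>] floor_multiple_Suc[OF \<beta>] eq by simp
  qed simp
  have close: "real n * \<bar>\<alpha> - \<beta>\<bar> < 1" for n
  proof -
    have "\<bar>real n * \<alpha> - real n * \<beta>\<bar> < 1"
      using floor_eq[of n] by simp linarith
    then show ?thesis
      by (simp add: abs_mult flip: right_diff_distrib)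
  qed
  obtain n where "1 < real n * \<bar>\<alpha> - \<beta>\<bar>"
    using reals_Archimedean3[of "\<bar>\<alpha> - \<beta>\<bar>"] \<open>\<alpha> \<noteq> \<beta>\<close> by auto
  with close[of n] show False
    by simp
qed

section \<open>Counting definable sets\<close>

instance add_symbol :: countable by countable_datatype
instance cyc_symbol :: countable by countable_datatype
instance fo_term :: (countable) countable by countable_datatype
instance fo_formula :: (countable, countable) countable by countable_datatype

lemma countable_definable:
  fixes M :: "('f::countable, 'r::countable, 'm::countable) fo_structure"
  shows "countable {S. definable M k S}"
proof (rule countable_subset)
  show "{S. definable M k S} \<subseteq>
    range (\<lambda>(\<phi>, ps). {xs. length xs = k \<and> satisfies M (\<lambda>i. (xs @ ps) ! i) \<phi>})"
    unfolding definable_def by auto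
qed simp

definition triple_lists :: "('a \<times> 'a \<times> 'a) set \<Rightarrow> 'a list set" where
  "triple_lists C = {[a, b, c] | a b c. (a, b, c) \<in> C}"

lemma inj_triple_lists: "inj triple_lists"
proof (rule injI)
  fix C D :: "('a \<times> 'a \<times> 'a) set"
  assume eq: "triple_lists C = triple_lists D"
  have "(a, b, c) \<in> E \<longleftrightarrow> [a, b, c] \<in> triple_lists E" for a b c :: 'a and E
    by (simp add: triple_lists_def)
  with eq show "C = D"
    by auto
qed

lemma definable_triple_lists: "definable (cyc_structure C) 3 (triple_lists C)"
  unfolding definable_def
proof (intro exI conjI)
  let ?\<phi> = "Rel Cyc [Var 0, Var 1, Var 2] :: (add_symbol, cyc_symbol) fo_formula"
  show "wf_formula (cyc_structure C) ?\<phi>"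
    by (simp add: cyc_structure_def)
  show "free_vars ?\<phi> \<subseteq> {..<3 + length ([] :: 'a list)}"
    by auto
  show "triple_lists C =
    {xs. length xs = 3 \<and> satisfies (cyc_structure C) (\<lambda>i. (xs @ []) ! i) ?\<phi>}"
    by (auto simp: triple_lists_def cyc_structure_def length_Suc_conv numeral_3_eq_3)
qed

lemma countable_reducts:
  fixes D :: "('a::{ab_group_add, countable} \<times> 'a \<times> 'a) set"
  shows "countable {C. reduct_of (cyc_structure C) (cyc_structure D)}"
proof -
  have "triple_lists ` {C. reduct_of (cyc_structure C) (cyc_structure D)}
      \<subseteq> {S. definable (cyc_structure D) 3 S}"
    using definable_triple_lists by (auto simp: reduct_of_def)
  then have "countable (triple_lists ` {C. reduct_of (cyc_structure C) (cyc_structure D)})"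
    using countable_definable countable_subset by blast
  then show ?thesis
    by (rule countable_image_inj_on) (rule inj_on_subset[OF inj_triple_lists subset_UNIV])
qed

section \<open>Representatives of definable equivalence\<close>

lemma definably_equivalent_refl: "definably_equivalent M M"
  by (simp add: definably_equivalent_def reduct_of_def)

lemma definably_equivalent_sym: "definably_equivalent M N \<Longrightarrow> definably_equivalent N M"
  by (simp add: definably_equivalent_def)

lemma definably_equivalent_trans:
  "definably_equivalent M N \<Longrightarrow> definably_equivalent N P \<Longrightarrow> definably_equivalent M P"
  unfolding definably_equivalent_def reduct_of_def by blast

theorem corollary3p7:
  shows "\<exists>\<F> :: (int \<times> int \<times> int) set set.
    \<F> \<approx> (UNIV :: nat set set) \<and>
    (\<forall>C\<in>\<F>. additive_cyclic_order C) \<and>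
    (\<forall>C\<in>\<F>. \<forall>D\<in>\<F>. C \<noteq> D \<longrightarrow>
       \<not> definably_equivalent (cyc_structure C) (cyc_structure D))"
proof -
  define X where "X = rotation_order ` ({0<..<1} - \<rat>)"
  have "X \<approx> {0<..<1::real} - \<rat>"
    unfolding X_def by (rule inj_on_image_eqpoll_self[OF inj_on_rotation_order])
  also note irrational_unit_interval_eqpoll
  finally have X_reals: "X \<approx> (UNIV :: real set)" .
  have unc: "uncountable X"
    using countable_eqpoll[OF _ eqpoll_sym[OF X_reals]] uncountable_UNIV_real by blast
  define equiv :: "(int \<times> int \<times> int) set \<Rightarrow> (int \<times> int \<times> int) set \<Rightarrow> bool"
    where "equiv C D = definably_equivalent (cyc_structure C) (cyc_structure D)" for C D
  have equiv_refl: "equiv C C" for C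
    by (simp add: equiv_def definably_equivalent_refl)
  have equiv_sym: "equiv C D \<Longrightarrow> equiv D C" for C D
    by (simp add: equiv_def definably_equivalent_sym)
  have equiv_trans: "equiv C D \<Longrightarrow> equiv D E \<Longrightarrow> equiv C E" for C D E
    unfolding equiv_def by (rule definably_equivalent_trans)
  define rep where "rep C = (SOME D. D \<in> X \<and> equiv C D)" for C
  have rep: "rep C \<in> X \<and> equiv C (rep C)" if "C \<in> X" for C
    unfolding rep_def by (rule someI[of _ C]) (simp add: that equiv_refl)
  \<comment> \<open>The choice only looks at the class of \<open>C\<close>, which equivalent orders share.\<close>
  have rep_cong: "rep C = rep D" if "equiv C D" for C D
  proof -
    have "equiv C E \<longleftrightarrow> equiv D E" for E
      using equiv_trans[OF that] equiv_trans[OF equiv_sym[OF that]] by (rule iffI[rotated])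
    then show ?thesis
      by (simp add: rep_def)
  qed
  have "rep ` X \<approx> X"
  proof (rule image_eqpoll_if_countable_fibres[OF unc])
    fix C
    assume "C \<in> X"
    have "equiv D C" if "D \<in> X" "rep D = rep C" for D
    proof (rule equiv_trans)
      show "equiv D (rep C)"
        using rep[OF that(1)] that(2) by simp
      show "equiv (rep C) C"
        using rep[OF \<open>C \<in> X\<close>] equiv_sym by simp
    qed
    then have "{D \<in> X. rep D = rep C} \<subseteq> {D. reduct_of (cyc_structure D) (cyc_structure C)}"
      by (auto simp: equiv_def definably_equivalent_def)
    then show "countable {D \<in> X. rep D = rep C}"
      using countable_reducts countable_subset by blast
  qed
  also note X_reals
  also note nat_sets_eqpoll_reals[THEN eqpoll_sym]
  finally have "rep ` X \<approx> (UNIV :: nat set set)" .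
  moreover have "additive_cyclic_order C" if "C \<in> rep ` X" for C
  proof -
    have "C \<in> X"
      using that rep by auto
    then show ?thesis
      by (auto simp: X_def intro: additive_rotation_order)
  qed
  moreover have "C = D" if CD: "C \<in> rep ` X" "D \<in> rep ` X" "equiv C D" for C D
  proof -
    obtain C' D' where C': "C' \<in> X" "C = rep C'" and D': "D' \<in> X" "D = rep D'"
      using CD(1,2) by blast
    have "rep C' = rep C" "rep D' = rep D"
      using rep_cong[of C' C] rep_cong[of D' D] rep[of C'] rep[of D'] C' D' by simp_all
    then show ?thesis
      using rep_cong[OF CD(3)] C'(2) D'(2) by simp
  qed
  ultimately show ?thesis
    unfolding equiv_def by (intro exI[of _ "rep ` X"]) blast
qed

end
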